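(* If $(H\text{-}SD)$, $$\dot x(t)+\nabla_Hf_{|\mathcal{F}}(x(t))=0,\quad x(0)=x^0\in\mathcal{F},$$ is well-posed (i.e. its maximal solution $x$ is defined on $(T_m,T_M)$ with $T_M=+\infty$) and $f$ is convex, then for all $a\in\mathcal{F}$ and all $t>0$, $$f(x(t))\le f(a)+\frac1tD_h(a,x^0),$$ hence $\lim_{t\to+\infty}f(x(t))=\inf_{\overline{\mathcal{F}}}f$.
   Context: Let $m<n$ be positive integers, $A\in\mathbb{R}^{m\times n}$ of full rank, $b\in\operatorname{Im}A$, $\mathcal{A}=\{x\in\mathbb{R}^n: Ax=b\}$, $\mathcal{A}_0=\ker A$. Let $C\subset\mathbb{R}^n$ be nonempty, open and convex, with $\mathcal{F}=C\cap\mathcal{A}\neq\emptyset$ and $\overline{\mathcal{F}}=\overline{C}\cap\mathcal{A}$. The function $f\in\mathcal{C}^1(\mathbb{R}^n)$ has locally Lipschitz continuous gradient $\nabla f$ on $\mathbb{R}^n$. $\Gamma_0(\mathbb{R}^n)$ is the set of lower semicontinuous proper convex functions $\mathbb{R}^n\to\mathbb{R}\cup\{+\infty\}$. A function $h\in\Gamma_0(\mathbb{R}^n)$ is essentially smooth if it is differentiable on $\operatorname{int}\operatorname{dom}h$ and $|\nabla h(x^j)|\to+\infty$ for every sequence $(x^j)\subset\operatorname{int}\operatorname{dom}h$ converging to a boundary point of $\operatorname{dom}h$; it is of Legendre type if moreover it is strictly convex on $\operatorname{int}\operatorname{dom}h$. The function $h\in\Gamma_0(\mathbb{R}^n)$ is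 assumed to satisfy: (i) $h$ is of Legendre type with $\operatorname{int}\operatorname{dom}h=C$; (ii) $h_{|C}\in\mathcal{C}^2(C;\mathbb{R})$ and $\nabla^2h(x)$ is symmetric positive definite for all $x\in C$; (iii) $x\mapsto\nabla^2h(x)$ is locally Lipschitz continuous on $C$. Set $H=\nabla^2h$ on $C$, and $D_h(x,y)=h(x)-h(y)-\langle\nabla h(y),x-y\rangle$ for $x\in\operatorname{dom}h$, $y\in C$. On the submanifold $\mathcal{F}$, with tangent space $\mathcal{A}_0$, consider the Riemannian metric $(u,v)^H_x=\langle H(x)u,v\rangle$; the gradient of $f_{|\mathcal{F}}$ is $\nabla_Hf_{|\mathcal{F}}(x)=H(x)^{-1}[I-A^T(AH(x)^{-1}A^T)^{-1}AH(x)^{-1}]\nabla f(x)$. *)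

theory Defs
  imports "HOL-Analysis.Analysis"
begin

definition grad :: "('a::real_inner \<Rightarrow> real) \<Rightarrow> 'a \<Rightarrow> 'a" where
  "grad f x = (THE D. GDERIV f x :> D)"

definition hess :: "(real^'n \<Rightarrow> real) \<Rightarrow> real^'n \<Rightarrow> real^'n^'n" where
  "hess f x = matrix (frechet_derivative (grad f) (at x))"

definition C1_on :: "(real^'n) set \<Rightarrow> (real^'n \<Rightarrow> real) \<Rightarrow> bool" where
  "C1_on S f \<longleftrightarrow> (\<forall>x\<in>S. f differentiable (at x)) \<and> continuous_on S (grad f)"

definition C2_on :: "(real^'n) set \<Rightarrow> (real^'n \<Rightarrow> real) \<Rightarrow> bool" where
  "C2_on S f \<longleftrightarrow> C1_on S f \<and> (\<forall>x\<in>S. grad f differentiable (at x)) \<and> continuous_on S (hess f)"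

text \<open>The library notion of local Lipschitz continuity concerns families indexed by a time
  parameter; it is used here for a constant family.\<close>

definition locally_lipschitz_on :: "'a::metric_space set \<Rightarrow> ('a \<Rightarrow> 'b::metric_space) \<Rightarrow> bool" where
  "locally_lipschitz_on S g \<longleftrightarrow> local_lipschitz (UNIV :: real set) S (\<lambda>_. g)"

definition symmetric_pos_def :: "real^'n^'n \<Rightarrow> bool" where
  "symmetric_pos_def M \<longleftrightarrow> transpose M = M \<and> (\<forall>v. v \<noteq> 0 \<longrightarrow> 0 < (M *v v) \<bullet> v)"

definition strictly_convex_on :: "'a::real_vector set \<Rightarrow> ('a \<Rightarrow> real) \<Rightarrow> bool" where
  "strictly_convex_on S g \<longleftrightarrow> convex S \<and>
     (\<forall>x\<in>S. \<forall>y\<in>S. \<forall>t. x \<noteq> y \<longrightarrow> 0 < t \<longrightarrow> t < 1 \<longrightarrow>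
        g ((1 - t) *\<^sub>R x + t *\<^sub>R y) < (1 - t) * g x + t * g y)"

text \<open>Convex functions with values in \<open>\<real> \<union> {+\<infinity>}\<close> are modelled by \<open>ereal\<close>-valued functions
  which never take the value \<open>-\<infinity>\<close>. On their domain, \<open>finite_part\<close> is the underlying
  real-valued function; outside it is a dummy value.\<close>

definition dom_of :: "('a \<Rightarrow> ereal) \<Rightarrow> 'a set" where
  "dom_of h = {x. h x < \<infinity>}"

definition finite_part :: "('a \<Rightarrow> ereal) \<Rightarrow> 'a \<Rightarrow> real" where
  "finite_part h x = real_of_ereal (h x)"

definition Gamma0 :: "('a::euclidean_space \<Rightarrow> ereal) set" where
  "Gamma0 = {h. (\<forall>x. h x \<le> Liminf (at x) h) \<and>
                (\<forall>x. h x \<noteq> -\<infinity>) \<and> dom_of h \<noteq> {} \<and>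
                convex {(x, r::real). h x \<le> ereal r}}"

definition essentially_smooth :: "('a::euclidean_space \<Rightarrow> ereal) \<Rightarrow> bool" where
  "essentially_smooth h \<longleftrightarrow>
     (\<forall>x \<in> interior (dom_of h). finite_part h differentiable (at x)) \<and>
     (\<forall>X z. (\<forall>j::nat. X j \<in> interior (dom_of h)) \<longrightarrow> z \<in> frontier (dom_of h) \<longrightarrow>
        X \<longlonglongrightarrow> z \<longrightarrow>
        filterlim (\<lambda>j. norm (grad (finite_part h) (X j))) at_top sequentially)"

definition legendre_type :: "('a::euclidean_space \<Rightarrow> ereal) \<Rightarrow> bool" where
  "legendre_type h \<longleftrightarrow>
     essentially_smooth h \<and> strictly_convex_on (interior (dom_of h)) (finite_part h)"

definition bregman :: "('a::euclidean_space \<Rightarrow> ereal) \<Rightarrow> 'a \<Rightarrow> 'a \<Rightarrow> real" where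
  "bregman h x y =
     finite_part h x - finite_part h y - grad (finite_part h) y \<bullet> (x - y)"

definition ker :: "real^'n^'m \<Rightarrow> (real^'n) set" where
  "ker A = {v. A *v v = 0}"

definition hess_metric :: "(real^'n \<Rightarrow> ereal) \<Rightarrow> real^'n \<Rightarrow> real^'n \<Rightarrow> real^'n \<Rightarrow> real" where
  "hess_metric h x u v = (hess (finite_part h) x *v u) \<bullet> v"

text \<open>The gradient, with respect to \<open>hess_metric\<close>, of the restriction of \<open>f\<close> to an open piece of
  an affine subspace with direction \<open>ker A\<close>: the tangent vector representing the differential
  of \<open>f\<close> on the tangent space.\<close>

definition riem_grad ::
  "real^'n^'m \<Rightarrow> (real^'n \<Rightarrow> ereal) \<Rightarrow> (real^'n \<Rightarrow> real) \<Rightarrow> real^'n \<Rightarrow> real^'n" where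
  "riem_grad A h f x =
     (THE w. w \<in> ker A \<and> (\<forall>v\<in>ker A. hess_metric h x w v = grad f x \<bullet> v))"

lemma matrix_inv_props:
  fixes M :: "real^'n^'n"
  assumes "invertible M"
  shows "M ** matrix_inv M = mat 1" "matrix_inv M ** M = mat 1"
proof -
  have "M ** matrix_inv M = mat 1 \<and> matrix_inv M ** M = mat 1"
    unfolding matrix_inv_def by (rule someI_ex) (use assms in \<open>simp add: invertible_def\<close>)
  then show "M ** matrix_inv M = mat 1" "matrix_inv M ** M = mat 1" by auto
qed

lemma symmetric_pos_def_invertible:
  assumes "symmetric_pos_def M"
  shows "M ** matrix_inv M = mat 1" "matrix_inv M ** M = mat 1"
proof -
  have "\<forall>v. M *v v = 0 \<longrightarrow> v = 0"
    using assms unfolding symmetric_pos_def_def by (metis inner_zero_left less_irrefl)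
  then have "\<exists>B. B ** M = mat 1"
    by (simp add: matrix_left_invertible_ker)
  then have "invertible M"
    by (simp add: invertible_left_inverse)
  then show "M ** matrix_inv M = mat 1" "matrix_inv M ** M = mat 1"
    by (rule matrix_inv_props)+
qed

text \<open>The explicit formula for the gradient, which also shows that the description in
  \<open>riem_grad\<close> is well-defined.\<close>

lemma riem_grad_formula:
  fixes A :: "real^'n^'m"
  assumes rk: "rank A = CARD('m)" and H: "symmetric_pos_def (hess (finite_part h) x)"
  defines "K \<equiv> matrix_inv (hess (finite_part h) x)"
  shows "riem_grad A h f x =
    (K ** (mat 1 - transpose A ** matrix_inv (A ** K ** transpose A) ** A ** K)) *v grad f x"
proof -
  define M where "M = hess (finite_part h) x"
  define S where "S = A ** K ** transpose A"
  define w where "w = (K ** (mat 1 - transpose A ** matrix_inv S ** A ** K)) *v grad f x"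
  define l where "l = matrix_inv S *v (A *v (K *v grad f x))"
  have M: "symmetric_pos_def M" using H by (simp add: M_def)
  have MK: "M ** K = mat 1"
    using symmetric_pos_def_invertible[OF M] by (simp add: K_def M_def)
  have MKv: "M *v (K *v v) = v" for v
    by (simp add: matrix_vector_mul_assoc MK)
  have pd: "v \<noteq> 0 \<Longrightarrow> 0 < (M *v v) \<bullet> v" for v
    using M by (simp add: symmetric_pos_def_def)
  have surjA: "surj ((*v) A)" using rk by (simp add: full_rank_surjective)
  have Sv: "S *v y = A *v (K *v (transpose A *v y))" for y
    by (simp only: S_def matrix_vector_mul_assoc matrix_mul_assoc)
  have tr: "(transpose A *v y) \<bullet> v = y \<bullet> (A *v v)" for y v
    by (simp add: dot_lmul_matrix[symmetric])
  note transpose_matrix_vector [simp del]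
  have inj: "y = 0" if "S *v y = 0" for y
  proof -
    define z where "z = transpose A *v y"
    define u where "u = K *v z"
    have "(M *v u) \<bullet> u = y \<bullet> (S *v y)"
      by (simp only: u_def MKv z_def tr Sv)
    then have "u = 0" using pd[of u] that by fastforce
    then have "z = 0" using MKv[of z] by (simp add: u_def)
    obtain v where "A *v v = y" using surjA by (metis surjD)
    then have "y \<bullet> y = z \<bullet> v" by (simp add: z_def tr)
    then show ?thesis using \<open>z = 0\<close> by simp
  qed
  then have "invertible S"
    by (simp add: invertible_left_inverse matrix_left_invertible_ker)
  then have Sl: "S *v l = A *v (K *v grad f x)"
    using matrix_inv_props(1)[of S]
    by (metis l_def matrix_vector_mul_assoc matrix_vector_mul_lid)
  have w: "w = K *v (grad f x - transpose A *v l)"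
    by (simp add: w_def l_def matrix_vector_mul_assoc[symmetric] matrix_vector_mult_diff_rdistrib
        matrix_mul_assoc[symmetric])
  have wker: "w \<in> ker A"
    using Sl by (simp add: w ker_def matrix_vector_mult_diff_distrib Sv)
  have Mw: "M *v w = grad f x - transpose A *v l" by (simp add: w MKv)
  have wrep: "\<forall>v\<in>ker A. hess_metric h x w v = grad f x \<bullet> v"
    unfolding hess_metric_def M_def[symmetric] Mw
    by (auto simp: ker_def inner_diff_left tr)
  have "riem_grad A h f x = w"
    unfolding riem_grad_def
  proof (rule the_equality)
    show "w \<in> ker A \<and> (\<forall>v\<in>ker A. hess_metric h x w v = grad f x \<bullet> v)"
      using wker wrep by blast
  next
    fix w' assume a: "w' \<in> ker A \<and> (\<forall>v\<in>ker A. hess_metric h x w' v = grad f x \<bullet> v)"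
    have d: "w' - w \<in> ker A"
      using a wker by (simp add: ker_def matrix_vector_mult_diff_distrib)
    then have "hess_metric h x w' (w' - w) = hess_metric h x w (w' - w)"
      using a wrep by simp
    then have "(M *v (w' - w)) \<bullet> (w' - w) = 0"
      by (simp add: hess_metric_def M_def[symmetric] matrix_vector_mult_diff_distrib inner_diff_left)
    then show "w' = w" using pd[of "w' - w"] by fastforce
  qed
  then show ?thesis by (simp add: w_def S_def)
qed

text \<open>A solution of \<open>x' + riem_grad A h f x = 0\<close>, \<open>x 0 = x0\<close>, on the open interval \<open>(Tm, TM)\<close>,
  with values in \<open>F\<close>.\<close>

definition HSD_solution ::
  "real^'n^'m \<Rightarrow> (real^'n) set \<Rightarrow> (real^'n \<Rightarrow> ereal) \<Rightarrow> (real^'n \<Rightarrow> real) \<Rightarrow> real^'n \<Rightarrow>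
   ereal \<Rightarrow> ereal \<Rightarrow> (real \<Rightarrow> real^'n) \<Rightarrow> bool" where
  "HSD_solution A F h f x0 Tm TM x \<longleftrightarrow>
     Tm < 0 \<and> 0 < TM \<and> x 0 = x0 \<and>
     (\<forall>t. Tm < ereal t \<longrightarrow> ereal t < TM \<longrightarrow>
        x t \<in> F \<and> (x has_vector_derivative - riem_grad A h f (x t)) (at t))"

definition HSD_maximal_solution ::
  "real^'n^'m \<Rightarrow> (real^'n) set \<Rightarrow> (real^'n \<Rightarrow> ereal) \<Rightarrow> (real^'n \<Rightarrow> real) \<Rightarrow> real^'n \<Rightarrow>
   ereal \<Rightarrow> ereal \<Rightarrow> (real \<Rightarrow> real^'n) \<Rightarrow> bool" where
  "HSD_maximal_solution A F h f x0 Tm TM x \<longleftrightarrow>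
     HSD_solution A F h f x0 Tm TM x \<and>
     (\<forall>Tm' TM' y. HSD_solution A F h f x0 Tm' TM' y \<longrightarrow> Tm' \<le> Tm \<longrightarrow> TM \<le> TM' \<longrightarrow>
        (\<forall>t. Tm < ereal t \<longrightarrow> ereal t < TM \<longrightarrow> y t = x t) \<longrightarrow> Tm' = Tm \<and> TM' = TM)"

end

theory Submission
  imports Defs
begin

text \<open>Along the flow, the pairing of \<open>H x'\<close> with tangent vectors is \<open>- \<nabla>f\<close>, so the derivative
  of \<open>D\<^sub>h(a, x(t))\<close> is \<open>\<nabla>f(x(t)) \<bullet> (a - x(t)) \<le> f a - f (x t)\<close> by convexity of \<open>f\<close>, while \<open>f\<close>
  itself decreases. Hence \<open>t (f (x t) - f a) + D\<^sub>h(a, x(t))\<close> is nonincreasing for \<open>t \<ge> 0\<close>, and the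
  estimate follows from \<open>D\<^sub>h \<ge> 0\<close>.\<close>

section \<open>Gradients and derivatives along curves\<close>

text \<open>Since \<open>grad\<close> is a definite description, existence and uniqueness have to be
  shown. Existence is Riesz representation: the adjoint of the derivative, applied to 1, represents
  it. Uniqueness is inherited from the derivative.\<close>

lemma GDERIV_grad:
  fixes f :: "'a::euclidean_space \<Rightarrow> real"
  assumes "f differentiable (at x)"
  shows "GDERIV f x :> grad f x"
proof -
  obtain f' where f': "(f has_derivative f') (at x)"
    using assms by (auto simp: differentiable_def)
  have "f' v = v \<bullet> adjoint f' 1" for v
    using adjoint_works[OF has_derivative_linear[OF f'], of v 1] by simp
  then have D: "GDERIV f x :> adjoint f' 1"
    unfolding gderiv_def by (rule has_derivative_eq_rhs[OF f' ext])
  show ?thesis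
    unfolding grad_def
  proof (rule theI[of "\<lambda>D. GDERIV f x :> D", OF D])
    fix D' assume "GDERIV f x :> D'"
    then have "(\<lambda>v. v \<bullet> D') = (\<lambda>v. v \<bullet> adjoint f' 1)"
      using D unfolding gderiv_def by (rule has_derivative_unique)
    then have "v \<bullet> D' = v \<bullet> adjoint f' 1" for v
      by meson
    then show "D' = adjoint f' 1"
      using vector_eq_rdot by (metis inner_commute)
  qed
qed

lemma has_derivative_grad:
  fixes f :: "real^'n \<Rightarrow> real"
  assumes "grad f differentiable (at x)"
  shows "(grad f has_derivative (\<lambda>v. hess f x *v v)) (at x)"
proof -
  have D: "(grad f has_derivative frechet_derivative (grad f) (at x)) (at x)"
    using assms frechet_derivative_works by blast
  have "(\<lambda>v. hess f x *v v) = frechet_derivative (grad f) (at x)"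
    unfolding hess_def using has_derivative_linear[OF D] by (rule matrix_vector_mul(2))
  then show ?thesis
    using D by simp
qed

lemma GDERIV_chain_vector_derivative:
  assumes "GDERIV f (x t) :> D" "(x has_vector_derivative v) (at t)"
  shows "((\<lambda>t. f (x t)) has_real_derivative D \<bullet> v) (at t)"
proof -
  have "((\<lambda>t. f (x t)) has_derivative (\<lambda>s. (s *\<^sub>R v) \<bullet> D)) (at t)"
    using has_derivative_compose[of x "\<lambda>s. s *\<^sub>R v" t UNIV f "\<lambda>h. h \<bullet> D"] assms
    by (simp add: gderiv_def has_vector_derivative_def)
  then show ?thesis
    by (simp add: has_field_derivative_def inner_commute[of v] mult_commute_abs)
qed

section \<open>Gradient inequality for convex functions\<close>

text \<open>Restricting \<open>f\<close> to the line through \<open>y\<close> and \<open>z\<close>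
  reduces the claim to one variable: a convex function lies above its tangent at 0, evaluated at 1.
  Openness of \<open>S\<close> makes 0 an interior parameter.\<close>

lemma convex_on_above_gradient:
  fixes f :: "'a::euclidean_space \<Rightarrow> real"
  assumes cvx: "convex_on S f" and "open S" and S: "y \<in> S" "z \<in> S"
    and D: "GDERIV f y :> D"
  shows "f y + D \<bullet> (z - y) \<le> f z"
proof -
  define l where "l t = y + t *\<^sub>R (z - y)" for t :: real
  define T where "T = l -` S"
  \<comment> \<open>\<open>l\<close> is affine, so convexity passes from \<open>S\<close> to
    \<open>T\<close> and from \<open>f\<close> to \<open>f \<circ> l\<close>.\<close>
  have l: "l ((1 - u) *\<^sub>R s + u *\<^sub>R t) = (1 - u) *\<^sub>R l s + u *\<^sub>R l t" for s t u
    by (simp add: l_def algebra_simps)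
  have "convex S"
    using cvx by (simp add: convex_on_def)
  then have "convex T"
    by (auto simp: convex_alt T_def l[simplified])
  have "open T"
    unfolding T_def l_def using \<open>open S\<close> by (intro open_vimage continuous_intros)
  have conv: "convex_on T (f \<circ> l)"
  proof
    show "(f \<circ> l) ((1 - u) *\<^sub>R s + u *\<^sub>R t) \<le> (1 - u) * (f \<circ> l) s + u * (f \<circ> l) t"
      if "0 < u" "u < 1" "s \<in> T" "t \<in> T" for u s t
      using convex_onD[OF cvx, of u "l s" "l t"] that unfolding o_apply l by (simp add: T_def)
  qed fact
  have l': "(l has_vector_derivative (z - y)) (at 0)"
    unfolding l_def by (auto intro!: derivative_eq_intros)
  have "((\<lambda>t. f (l t)) has_real_derivative D \<bullet> (z - y)) (at 0)"
    using D by (intro GDERIV_chain_vector_derivative[OF _ l']) (simp add: l_def)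
  then have "(f \<circ> l has_real_derivative D \<bullet> (z - y)) (at 0 within T)"
    unfolding o_def by (rule has_field_derivative_at_within)
  moreover have "0 \<in> interior T" "1 \<in> T"
    using S \<open>open T\<close> by (auto simp: interior_open T_def l_def)
  ultimately have "D \<bullet> (z - y) * (1 - 0) \<le> (f \<circ> l) 1 - (f \<circ> l) 0"
    using convex_on_imp_above_tangent[OF conv convex_connected[OF \<open>convex T\<close>]] by blast
  then show ?thesis
    by (simp add: l_def)
qed

lemma strictly_convex_on_imp_convex_on:
  assumes "strictly_convex_on S g"
  shows "convex_on S g"
proof
  show "convex S"
    using assms by (simp add: strictly_convex_on_def)
  show "g ((1 - t) *\<^sub>R x + t *\<^sub>R y) \<le> (1 - t) * g x + t * g y"
    if "0 < t" "t < 1" "x \<in> S" "y \<in> S" for t x y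
  proof (cases "x = y")
    case True
    then show ?thesis by (simp add: left_diff_distrib)
  next
    case False
    then show ?thesis
      using assms that by (simp add: strictly_convex_on_def less_imp_le)
  qed
qed

text \<open>Positive definiteness makes \<open>M S\<close> a complement of the orthogonal complement of \<open>S\<close>.\<close>

lemma pos_def_representation:
  fixes M :: "real^'n^'n"
  assumes "subspace S" and pd: "\<And>v. v \<in> S \<Longrightarrow> v \<noteq> 0 \<Longrightarrow> 0 < (M *v v) \<bullet> v"
  shows "\<exists>w\<in>S. \<forall>v\<in>S. (M *v w) \<bullet> v = d \<bullet> v"
proof -
  define P where "P = {y. \<forall>x\<in>S. orthogonal x y}"
  have "subspace P"
    unfolding P_def by (rule subspace_orthogonal_to_vectors)
  have linM: "linear ((*v) M)"
    by simp
  \<comment> \<open>The kernel of \<open>M\<close> meets \<open>S\<close> only in 0, so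
    \<open>M\<close> preserves the dimension of \<open>S\<close>.\<close>
  have "inj_on ((*v) M) (span S)"
  proof (rule inj_onI)
    fix u v assume uv: "u \<in> span S" "v \<in> span S" "M *v u = M *v v"
    then have "u - v \<in> S"
      using \<open>subspace S\<close> by (metis span_eq_iff subspace_diff)
    moreover have "(M *v (u - v)) \<bullet> (u - v) = 0"
      using uv by (simp add: matrix_vector_mult_diff_distrib)
    ultimately show "u = v"
      using pd[of "u - v"] by fastforce
  qed
  then have dimM: "dim ((*v) M ` S) = dim S"
    using dim_image_eq[OF linM] by blast
  have subM: "subspace ((*v) M ` S)"
    using linear_subspace_image[OF linM \<open>subspace S\<close>] .
  \<comment> \<open>If \<open>M *v s\<close> is orthogonal to \<open>s\<close> itself, definiteness
    forces \<open>s = 0\<close>.\<close>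
  have "(*v) M ` S \<inter> P \<subseteq> {0}"
  proof
    fix y assume "y \<in> (*v) M ` S \<inter> P"
    then obtain s where "s \<in> S" "y = M *v s" "orthogonal s (M *v s)"
      by (auto simp: P_def)
    then show "y \<in> {0}"
      using pd[of s] by (cases "s = 0") (auto simp: orthogonal_def inner_commute)
  qed
  then have "dim ((*v) M ` S \<inter> P) = 0"
    by (simp add: dim_eq_0)
  moreover have "dim P + dim S = DIM(real^'n)"
    using dim_subspace_orthogonal_to_vectors[OF \<open>subspace S\<close> subspace_UNIV] by (simp add: P_def)
  ultimately have "dim {y + p |y p. y \<in> (*v) M ` S \<and> p \<in> P} = DIM(real^'n)"
    using dim_sums_Int[OF subM \<open>subspace P\<close>] dimM by linarith
  then have "{y + p |y p. y \<in> (*v) M ` S \<and> p \<in> P} = UNIV"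
    using subspace_sums[OF subM \<open>subspace P\<close>] by (simp only: dim_eq_full span_eq_iff[THEN iffD2])
  \<comment> \<open>The dimension count makes the sum the whole space; in a splitting of
    \<open>d\<close>, the part in \<open>P\<close> is invisible to test vectors from
    \<open>S\<close>.\<close>
  then have "d \<in> {y + p |y p. y \<in> (*v) M ` S \<and> p \<in> P}"
    by (simp only: UNIV_I)
  then obtain w p where "w \<in> S" "p \<in> P" and d: "d = M *v w + p"
    by auto
  have "p \<bullet> v = 0" if "v \<in> S" for v
    using that \<open>p \<in> P\<close> by (simp add: P_def orthogonal_def inner_commute[of v p, symmetric])
  then have "\<forall>v\<in>S. (M *v w) \<bullet> v = d \<bullet> v"
    by (simp add: d inner_add_left)
  then show ?thesis
    using \<open>w \<in> S\<close> by blast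
qed

lemma subspace_ker: "subspace (ker A)"
  by (simp add: subspace_def ker_def matrix_vector_right_distrib matrix_vector_mult_scaleR)

text \<open>This justifies the description in \<open>riem_grad\<close>:
  \<open>pos_def_representation\<close> on the tangent space gives existence, and testing the
  difference of two candidates against itself gives uniqueness. The flow is later used only through
  these two properties.\<close>

lemma riem_grad:
  assumes "symmetric_pos_def (hess (finite_part h) x)"
  shows riem_grad_in_ker: "riem_grad A h f x \<in> ker A"
    and hess_metric_riem_grad: "\<And>v. v \<in> ker A \<Longrightarrow> hess_metric h x (riem_grad A h f x) v = grad f x \<bullet> v"
proof -
  let ?M = "hess (finite_part h) x"
  let ?P = "\<lambda>w. w \<in> ker A \<and> (\<forall>v\<in>ker A. hess_metric h x w v = grad f x \<bullet> v)"
  have pd: "0 < (?M *v v) \<bullet> v" if "v \<noteq> 0" for v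
    using assms that by (simp add: symmetric_pos_def_def)
  obtain w where w: "?P w"
    using pos_def_representation[OF subspace_ker[of A], of ?M "grad f x"] pd
    unfolding hess_metric_def by blast
  have "w' = w" if "?P w'" for w'
  proof -
    have "w' - w \<in> ker A"
      using that w subspace_diff[OF subspace_ker] by blast
    then have "(?M *v (w' - w)) \<bullet> (w' - w) = 0"
      using that w by (simp add: hess_metric_def matrix_vector_mult_diff_distrib inner_diff_left)
    then show ?thesis
      using pd[of "w' - w"] by fastforce
  qed
  then have "?P (riem_grad A h f x)"
    unfolding riem_grad_def using w by (intro theI[of ?P w]) blast+
  then show "riem_grad A h f x \<in> ker A"
    and "\<And>v. v \<in> ker A \<Longrightarrow> hess_metric h x (riem_grad A h f x) v = grad f x \<bullet> v"
    by blast+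
qed

section \<open>The Bregman distance along a curve\<close>

lemma bregman_nonneg:
  assumes "convex_on C (finite_part h)" "open C" "a \<in> C" "y \<in> C"
    and "finite_part h differentiable (at y)"
  shows "0 \<le> bregman h a y"
  using convex_on_above_gradient[OF assms(1,2,4,3) GDERIV_grad[OF assms(5)]]
  by (simp add: bregman_def)

text \<open>Differentiating \<open>h\<close> along the curve and differentiating
  \<open>a - x t\<close> produce the same first-order term with opposite signs. Only the Hessian
  term survives, which is the metric pairing of the velocity with \<open>x t - a\<close>.\<close>

lemma bregman_has_derivative_along:
  fixes h :: "real^'n \<Rightarrow> ereal"
  assumes h: "finite_part h differentiable (at (x t))" "grad (finite_part h) differentiable (at (x t))"
    and x: "(x has_vector_derivative v) (at t)"
  shows "((\<lambda>t. bregman h a (x t)) has_real_derivative hess_metric h (x t) v (x t - a)) (at t)"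
proof -
  let ?g = "grad (finite_part h)"
  have "((\<lambda>t. ?g (x t)) has_vector_derivative hess (finite_part h) (x t) *v v) (at t)"
    using has_derivative_compose[OF x[unfolded has_vector_derivative_def] has_derivative_grad[OF h(2)]]
    by (simp add: has_vector_derivative_def matrix_vector_mult_scaleR)
  moreover have "((\<lambda>t. a - x t) has_vector_derivative - v) (at t)"
    using x by (auto intro!: derivative_eq_intros)
  ultimately have "((\<lambda>t. ?g (x t) \<bullet> (a - x t)) has_vector_derivative
      ?g (x t) \<bullet> - v + (hess (finite_part h) (x t) *v v) \<bullet> (a - x t)) (at t)"
    by (rule bounded_bilinear.has_vector_derivative[OF bounded_bilinear_inner])
  then have "((\<lambda>t. ?g (x t) \<bullet> (a - x t)) has_real_derivative
      ?g (x t) \<bullet> - v + (hess (finite_part h) (x t) *v v) \<bullet> (a - x t)) (at t)"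
    by (simp add: has_real_derivative_iff_has_vector_derivative)
  from DERIV_diff[OF DERIV_diff[OF DERIV_const GDERIV_chain_vector_derivative[OF GDERIV_grad[OF h(1)] x]] this]
  show ?thesis
    by (simp add: bregman_def hess_metric_def inner_diff_right)
qed

text \<open>Any rate of the form \<open>B a / t\<close>, with \<open>B\<close> arbitrary, suffices,
  because each competitor \<open>a\<close> is fixed before \<open>t\<close> grows. Values are taken
  in \<open>ereal\<close> since the infimum may be minus infinity.\<close>

lemma tendsto_INF_closure:
  fixes f :: "'a::topological_space \<Rightarrow> real"
  assumes cont: "continuous_on UNIV f"
    and ge: "\<And>t. t \<ge> 0 \<Longrightarrow> x t \<in> F"
    and le: "\<And>a t. a \<in> F \<Longrightarrow> t > 0 \<Longrightarrow> f (x t) \<le> f a + 1 / t * B a"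
  shows "((\<lambda>t::real. ereal (f (x t))) \<longlongrightarrow> (INF y\<in>closure F. ereal (f y))) at_top"
proof (rule order_tendstoI)
  fix c assume c: "c < (INF y\<in>closure F. ereal (f y))"
  have "c < ereal (f (x t))" if "t \<ge> 0" for t
    using INF_lower[of "x t" "closure F" "\<lambda>y. ereal (f y)"] ge[OF that] closure_subset[of F] c
    by (meson less_le_trans subsetD)
  then show "\<forall>\<^sub>F t in at_top. c < ereal (f (x t))"
    using eventually_ge_at_top by (rule eventually_mono[rotated])
next
  fix c assume "(INF y\<in>closure F. ereal (f y)) < c"
  then obtain y where y: "y \<in> closure F" "ereal (f y) < c"
    by (auto simp: INF_less_iff)
  \<comment> \<open>The bound is available only on \<open>F\<close>; an open sublevel set that meets
    the closure of \<open>F\<close> already contains a point of \<open>F\<close>.\<close>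
  have "open {z. ereal (f z) < c}"
    using cont by (intro open_Collect_less continuous_intros)
  then obtain a where a: "a \<in> F" "ereal (f a) < c"
    using y by (metis (mono_tags, lifting) disjoint_iff mem_Collect_eq open_Int_closure_eq_empty)
  have "((\<lambda>t. f a + 1 / t * B a) \<longlongrightarrow> f a + 0 * B a) at_top"
    using tendsto_inverse_0_at_top[OF filterlim_ident]
    by (intro tendsto_add tendsto_mult tendsto_const) (simp add: inverse_eq_divide)
  then have "((\<lambda>t. ereal (f a + 1 / t * B a)) \<longlongrightarrow> ereal (f a)) at_top"
    by (simp add: tendsto_ereal)
  then have "\<forall>\<^sub>F t in at_top. ereal (f a + 1 / t * B a) < c"
    using a(2) by (rule order_tendstoD)
  then show "\<forall>\<^sub>F t in at_top. ereal (f (x t)) < c"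
    using eventually_gt_at_top[of 0]
  proof eventually_elim
    case (elim t)
    then show ?case
      using le[OF a(1), of t] by (meson ereal_less_eq(3) le_less_trans)
  qed
qed

section \<open>The estimate and the limit of the values\<close>

theorem proposition4p1:
  fixes A :: "real^'n^'m" and b :: "real^'m" and C F :: "(real^'n) set"
    and f :: "real^'n \<Rightarrow> real" and h :: "real^'n \<Rightarrow> ereal"
    and x0 :: "real^'n" and x :: "real \<Rightarrow> real^'n" and Tm TM :: ereal
  assumes "CARD('m) < CARD('n)"
    and "rank A = CARD('m)"
    and "b \<in> range (\<lambda>v. A *v v)"
    and "C \<noteq> {}" and "open C" and "convex C"
    and F_def: "F = C \<inter> {v. A *v v = b}"
    and "F \<noteq> {}"
    and "closure F = closure C \<inter> {v. A *v v = b}"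
    and "C1_on UNIV f" and "locally_lipschitz_on UNIV (grad f)"
    and "h \<in> Gamma0"
    and "legendre_type h" and "interior (dom_of h) = C"
    and "C2_on C (finite_part h)"
    and "\<forall>v\<in>C. symmetric_pos_def (hess (finite_part h) v)"
    and "locally_lipschitz_on C (hess (finite_part h))"
    and "x0 \<in> F"
    and "HSD_maximal_solution A F h f x0 Tm TM x" and "TM = \<infinity>"
    and "convex_on UNIV f"
  shows "(\<forall>a\<in>F. \<forall>t>0. f (x t) \<le> f a + 1 / t * bregman h a x0) \<and>
         ((\<lambda>t. ereal (f (x t))) \<longlongrightarrow> (INF y\<in>closure F. ereal (f y))) at_top"
proof -
  let ?\<phi> = "finite_part h"
  have F_C: "y \<in> C" if "y \<in> F" for y
    using that F_def by simp
  \<comment> \<open>\<open>Tm < 0\<close> and \<open>TM = \<infinity>\<close> put all nonnegative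
    times inside the interval of existence.\<close>
  have sol: "x t \<in> F" "(x has_vector_derivative - riem_grad A h f (x t)) (at t)" if "t \<ge> 0" for t
    using that \<open>HSD_maximal_solution A F h f x0 Tm TM x\<close> \<open>TM = \<infinity>\<close>
    unfolding HSD_maximal_solution_def HSD_solution_def
    by (auto simp: order.strict_trans2 zero_ereal_def)
  have "x 0 = x0"
    using \<open>HSD_maximal_solution A F h f x0 Tm TM x\<close>
    by (simp add: HSD_maximal_solution_def HSD_solution_def)
  have f: "GDERIV f y :> grad f y" for y
    using \<open>C1_on UNIV f\<close> by (simp add: C1_on_def GDERIV_grad)
  have \<phi>: "?\<phi> differentiable (at y)" "grad ?\<phi> differentiable (at y)" if "y \<in> C" for y
    using that \<open>C2_on C ?\<phi>\<close> by (auto simp: C2_on_def C1_on_def)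
  have cvx: "convex_on C ?\<phi>"
    using \<open>legendre_type h\<close> \<open>interior (dom_of h) = C\<close>
    by (simp add: legendre_type_def strictly_convex_on_imp_convex_on)
  have bound: "f (x t) \<le> f a + 1 / t * bregman h a x0" if "a \<in> F" "t > 0" for a t
  proof -
    define L where "L s = s * (f (x s) - f a) + bregman h a (x s)" for s
    have "\<exists>y. DERIV L s :> y \<and> y \<le> 0" if "0 \<le> s" for s
    proof -
      define w where "w = riem_grad A h f (x s)"
      note x' = sol(2)[OF that, folded w_def]
      have C: "x s \<in> C"
        using sol(1)[OF that] F_C by blast
      have pd: "symmetric_pos_def (hess ?\<phi> (x s))"
        using C \<open>\<forall>v\<in>C. symmetric_pos_def (hess ?\<phi> v)\<close> by blast
      have w: "w \<in> ker A" "\<And>v. v \<in> ker A \<Longrightarrow> hess_metric h (x s) w v = grad f (x s) \<bullet> v"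
        using riem_grad[OF pd] by (auto simp: w_def)
      \<comment> \<open>Both points solve \<open>A *v v = b\<close>, so their difference is tangent
        and may be tested against the gradient.\<close>
      have "x s - a \<in> ker A"
        using sol(1)[OF that] \<open>a \<in> F\<close> F_def by (simp add: ker_def matrix_vector_mult_diff_distrib)
      \<comment> \<open>The minus sign of the velocity \<open>- w\<close> is absorbed by reversing
        \<open>x s - a\<close>.\<close>
      from w(2)[OF this] have Hx': "hess_metric h (x s) (- w) (x s - a) = grad f (x s) \<bullet> (a - x s)"
        by (simp add: hess_metric_def inner_diff_right linear_neg[OF matrix_vector_mul_linear])
      have "((\<lambda>s. f (x s) - f a) has_real_derivative grad f (x s) \<bullet> - w) (at s)"
        using DERIV_diff[OF GDERIV_chain_vector_derivative[OF f x'] DERIV_const] by simp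
      note DERIV_add[OF DERIV_mult[OF DERIV_ident this]
          bregman_has_derivative_along[OF \<phi>[OF C] x', of a, unfolded Hx']]
      then have "DERIV L s :> f (x s) - f a + s * (grad f (x s) \<bullet> - w) + grad f (x s) \<bullet> (a - x s)"
        by (simp add: L_def[abs_def] algebra_simps)
      moreover have "f (x s) - f a + grad f (x s) \<bullet> (a - x s) \<le> 0"
        using convex_on_above_gradient[OF \<open>convex_on UNIV f\<close> _ _ _ f, of "x s" a] by simp
      \<comment> \<open>Testing \<open>w\<close> against itself turns this into
        \<open>(H w) \<bullet> w\<close>, which is nonnegative; it expresses that \<open>f\<close>
        decreases along the flow.\<close>
      moreover have "0 \<le> grad f (x s) \<bullet> w"
        using pd w by (cases "w = 0") (auto simp: symmetric_pos_def_def hess_metric_def less_imp_le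
            simp flip: w(2))
      then have "s * (grad f (x s) \<bullet> - w) \<le> 0"
        using that by simp
      ultimately show ?thesis
        by (intro exI[of _ "f (x s) - f a + s * (grad f (x s) \<bullet> - w) + grad f (x s) \<bullet> (a - x s)"])
          linarith
    qed
    \<comment> \<open>The factor \<open>s\<close> removes the first term of \<open>L\<close> at 0,
      so \<open>L 0\<close> is exactly the Bregman distance from \<open>a\<close> to
      \<open>x0\<close>.\<close>
    then have "L t \<le> L 0"
      using \<open>t > 0\<close> by (intro DERIV_nonpos_imp_nonincreasing[of 0 t L]) auto
    moreover have "0 \<le> bregman h a (x t)"
      using sol(1)[of t] \<open>t > 0\<close> \<open>a \<in> F\<close> F_C \<phi>(1)
      by (intro bregman_nonneg[OF cvx \<open>open C\<close>]) auto
    ultimately have "t * (f (x t) - f a) \<le> bregman h a x0"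
      by (simp add: L_def \<open>x 0 = x0\<close>)
    then show ?thesis
      using \<open>t > 0\<close> by (simp add: field_simps)
  qed
  have "continuous_on UNIV f"
    using f by (auto simp: gderiv_def continuous_on_eq_continuous_at intro: has_derivative_continuous)
  then show ?thesis
    using tendsto_INF_closure[of f x F "\<lambda>a. bregman h a x0"] sol(1) bound by blast
qed

end
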